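(* Let $X=(x_{i,j})$ and $Y=(y_{i,j})$ be independent uniformly random symmetric $d\times d$ matrices over $\mathbb{F}_q$ (so $x_{i,j}=x_{j,i}$, $y_{i,j}=y_{j,i}$). Define the $d\times d$ matrix $Z$ by $Z_{i,j}=x_{i,j}+y_{i,j+1}$ for $1\leq j\leq d-1$ and $Z_{i,d}=x_{i,d}+y_{i,1}$ (that is, $Z=X+Y\Pi$ where $\Pi$ is the permutation matrix cyclically shifting column $j+1$ to column $j$). Then $Z$ is a uniformly distributed random matrix in $\mathrm{M}(d,\mathbb{F}_q)$.
   Context: $\mathrm{M}(d,\mathbb{F}_q)$ is the space of $d\times d$ matrices over $\mathbb{F}_q$. Explicitly, the rows of $Z$ are $(x_{1,1}+y_{1,2}, x_{1,2}+y_{1,3},\dots,x_{1,d}+y_{1,1})$, $(x_{1,2}+y_{2,2}, x_{2,2}+y_{2,3},\dots,x_{2,d}+y_{1,2})$, $\dots$, $(x_{1,d}+y_{2,d}, x_{2,d}+y_{3,d},\dots,x_{d,d}+y_{1,d})$. *)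

theory Defs
  imports "HOL-Probability.Probability" "Jordan_Normal_Form.Matrix"
begin

definition sym_mats :: "nat \<Rightarrow> 'a mat set" where
  "sym_mats d = {A \<in> carrier_mat d d. transpose_mat A = A}"

text \<open>Matrix indices run from \<open>0\<close> to \<open>d - 1\<close>, so the last column has index \<open>d - 1\<close>; it receives the
  first column of \<open>Y\<close>, which has index \<open>0\<close>.\<close>

definition shift_sum :: "nat \<Rightarrow> 'a::plus mat \<Rightarrow> 'a mat \<Rightarrow> 'a mat" where
  "shift_sum d X Y = Matrix.mat d d (\<lambda>(i, j).
     if Suc j < d then X $$ (i, j) + Y $$ (i, Suc j) else X $$ (i, j) + Y $$ (i, 0))"

definition cyclic_shift_mat :: "nat \<Rightarrow> 'a::zero_neq_one mat" where
  "cyclic_shift_mat d = Matrix.mat d d (\<lambda>(k, j). if k = Suc j mod d then 1 else 0)"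

lemma shift_sum_eq_add_mult_cyclic_shift_mat:
  fixes X Y :: "'a::comm_ring_1 mat"
  assumes "X \<in> carrier_mat d d" and "Y \<in> carrier_mat d d"
  shows "shift_sum d X Y = X + Y * cyclic_shift_mat d"
proof (rule eq_matI)
  fix i j
  assume "i < dim_row (X + Y * cyclic_shift_mat d)" "j < dim_col (X + Y * cyclic_shift_mat d)"
  then have ij: "i < d" "j < d"
    using assms by (auto simp: cyclic_shift_mat_def)
  have "(Y * cyclic_shift_mat d) $$ (i, j)
      = (\<Sum>k = 0..<d. Y $$ (i, k) * (if k = Suc j mod d then 1 else 0))"
    using assms ij by (simp add: cyclic_shift_mat_def scalar_prod_def)
  also have "\<dots> = (\<Sum>k = 0..<d. if k = Suc j mod d then Y $$ (i, k) else 0)"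
    by (rule sum.cong) auto
  also have "\<dots> = Y $$ (i, Suc j mod d)"
    using ij by (subst sum.delta) auto
  also have "Suc j mod d = (if Suc j < d then Suc j else 0)"
    using ij by (auto simp: mod_Suc)
  finally show "shift_sum d X Y $$ (i, j) = (X + Y * cyclic_shift_mat d) $$ (i, j)"
    using assms ij by (auto simp: shift_sum_def cyclic_shift_mat_def)
qed (use assms in \<open>auto simp: shift_sum_def cyclic_shift_mat_def\<close>)

end

theory Submission
  imports Defs
begin

text \<open>The map \<open>(X, Y) \<mapsto> X + Y \<Pi>\<close> is additive, so all its nonempty fibres have the same size and it
  suffices to show that it is onto. Given \<open>Z\<close>, we need a symmetric \<open>Y\<close> such that \<open>Z - Y \<Pi>\<close> is
  symmetric, that is, \<open>Y\<^sub>i\<^sub>,\<^sub>j\<^sub>+\<^sub>1 - Y\<^sub>i\<^sub>+\<^sub>1\<^sub>,\<^sub>j = W\<^sub>i\<^sub>,\<^sub>j\<close> for the alternating matrix \<open>W = Z - Z\<^sup>T\<close>, with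
  indices modulo \<open>d\<close>. Along each antidiagonal this is a recurrence that is solved by partial sums of
  the entries of \<open>W\<close>. The solution is symmetric because the sum of \<open>W\<close> over a segment of an
  antidiagonal that is invariant under transposition vanishes.\<close>

text \<open>The reversal of the segment swaps the two indices, so the terms cancel in pairs. A
  middle term lies on the diagonal and vanishes by \<open>diag\<close>, which does not follow from
  \<open>anti\<close> in characteristic 2.\<close>

lemma sum_antidiagonal_alternating:
  fixes W :: "nat \<Rightarrow> nat \<Rightarrow> 'a::ab_group_add"
  assumes diag: "\<And>i. W i i = 0" and anti: "\<And>i j. W i j = - W j i"
  shows "(\<Sum>k=a..<b. W k (a + b - 1 - k)) = 0"
proof (induction "b - a" arbitrary: a b rule: less_induct)
  case less
  consider "b \<le> a" | "b = Suc a" | "Suc (Suc a) \<le> b" by linarith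
  then show ?case
  proof cases
    case 1
    then show ?thesis by simp
  next
    case 2
    then show ?thesis using diag by simp
  next
    case 3
    then obtain c where b: "b = Suc c" and c: "Suc a \<le> c"
      by (metis Suc_le_D Suc_le_mono)
    \<comment> \<open>Both end terms are split off. As \<open>Suc a + c - 1 = a + c\<close>, the
      rest stays on the same antidiagonal, so the induction hypothesis applies to it.\<close>
    have "(\<Sum>k=a..<b. W k (a + b - 1 - k))
        = W a c + (\<Sum>k=Suc a..<c. W k (a + c - k)) + W c a"
      using c by (simp add: b sum.atLeast_Suc_lessThan)
    also have "(\<Sum>k=Suc a..<c. W k (a + c - k)) = 0"
      using less[of c "Suc a"] b c by simp
    finally show ?thesis using anti[of a c] by simp
  qed
qed

text \<open>Unrolling the cyclic indices to all naturals lets the recurrence be solved without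
  wrap-around; the period of \<open>W\<close> passes to the solution.\<close>

lemma alternating_periodic_eq_antidiagonal_difference:
  fixes W :: "nat \<Rightarrow> nat \<Rightarrow> 'a::ab_group_add"
  assumes diag: "\<And>i. W i i = 0" and anti: "\<And>i j. W i j = - W j i"
    and per: "\<And>i j. W i (j + d) = W i j"
  obtains y where "\<And>a b. y a b = y b a" and "\<And>a b. y a (b + d) = y a b"
    and "\<And>i j. y i (Suc j) - y (Suc i) j = W i j"
proof
  \<comment> \<open>Start from \<open>y 0 b = 0\<close> and iterate
    \<open>y (Suc i) j = y i (Suc j) - W i j\<close> along the antidiagonal.\<close>
  define y where "y a b = - (\<Sum>k<a. W k (a + b - 1 - k))" for a b
  have le: "y b a = y a b" if "a \<le> b" for a b
  proof -
    have "(\<Sum>k<b. W k (a + b - 1 - k))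
        = (\<Sum>k<a. W k (a + b - 1 - k)) + (\<Sum>k=a..<b. W k (a + b - 1 - k))"
      using that by (subst sum.union_disjoint[symmetric]) (auto intro: sum.cong)
    also have "(\<Sum>k=a..<b. W k (a + b - 1 - k)) = 0"
      by (rule sum_antidiagonal_alternating[OF diag anti])
    finally show ?thesis by (simp add: y_def add.commute)
  qed
  show "y a b = y b a" for a b using le[of a b] le[of b a] by (cases "a \<le> b") auto
  show "y a (b + d) = y a b" for a b
  proof -
    have "W k (a + (b + d) - 1 - k) = W k (a + b - 1 - k)" if "k < a" for k
    proof -
      \<comment> \<open>For \<open>k < a\<close> the subtraction does not truncate, so the second
        index moves by exactly \<open>d\<close>.\<close>
      have "a + (b + d) - 1 - k = (a + b - 1 - k) + d" using that by auto
      then show ?thesis by (simp only: per)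
    qed
    then show ?thesis by (simp add: y_def)
  qed
  \<comment> \<open>Both sums follow the antidiagonal through \<open>(i, j)\<close>; only the second
    contains the term \<open>k = i\<close>.\<close>
  show "y i (Suc j) - y (Suc i) j = W i j" for i j
    by (simp add: y_def)
qed

lemma periodic_mod_eq:
  fixes g :: "nat \<Rightarrow> 'b"
  assumes "\<And>b. g (b + d) = g b"
  shows "g (b mod d) = g b"
proof -
  have "g (m + n * d) = g m" for m n
  proof (induction n)
    case (Suc n)
    then show ?case using assms[of "m + n * d"] by (simp add: ac_simps)
  qed simp
  from this[of "b mod d" "b div d"] show ?thesis by simp
qed

lemma shift_sum_index:
  assumes "i < d" "j < d"
  shows "shift_sum d X Y $$ (i, j) = X $$ (i, j) + Y $$ (i, Suc j mod d)"
  using assms by (auto simp: shift_sum_def mod_Suc)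

lemma sym_matsI:
  assumes "\<And>i j. i < d \<Longrightarrow> j < d \<Longrightarrow> f (j, i) = f (i, j)"
  shows "Matrix.mat d d f \<in> sym_mats d"
  using assms by (auto simp: sym_mats_def intro!: eq_matI)

lemma sym_matsD:
  assumes "A \<in> sym_mats d"
  shows "dim_row A = d" "dim_col A = d" "i < d \<Longrightarrow> j < d \<Longrightarrow> A $$ (j, i) = A $$ (i, j)"
proof -
  show *: "dim_row A = d" "dim_col A = d" using assms by (auto simp: sym_mats_def)
  have "transpose_mat A = A" using assms by (auto simp: sym_mats_def)
  then show "i < d \<Longrightarrow> j < d \<Longrightarrow> A $$ (j, i) = A $$ (i, j)"
    by (metis * index_transpose_mat(1))
qed

lemma shift_sum_surj:
  fixes Z :: "'a::ab_group_add mat"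
  assumes Z: "Z \<in> carrier_mat d d"
  obtains X Y where "X \<in> sym_mats d" "Y \<in> sym_mats d" "shift_sum d X Y = Z"
proof -
  define W where "W i j = Z $$ (i mod d, j mod d) - Z $$ (j mod d, i mod d)" for i j
  obtain y where sym: "\<And>a b. y a b = y b a" and per: "\<And>a b. y a (b + d) = y a b"
    and rec: "\<And>i j. y i (Suc j) - y (Suc i) j = W i j"
    by (rule alternating_periodic_eq_antidiagonal_difference[of W d]) (auto simp: W_def)
  define Y where "Y = Matrix.mat d d (\<lambda>(i, j). y i j)"
  \<comment> \<open>This choice is forced by \<open>shift_sum d X Y = Z\<close>. The index
    \<open>Suc j\<close> can stay unreduced, since periodicity of \<open>y\<close> identifies column
    \<open>d\<close> with column \<open>0\<close>.\<close>
  define X where "X = Matrix.mat d d (\<lambda>(i, j). Z $$ (i, j) - y i (Suc j))"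
  have "X \<in> sym_mats d"
    unfolding X_def
  proof (rule sym_matsI, clarsimp)
    fix i j assume "i < d" "j < d"
    \<comment> \<open>After \<open>sym\<close> rewrites \<open>y j (Suc i)\<close> as
      \<open>y (Suc i) j\<close>, this is the recurrence at \<open>(i, j)\<close>.\<close>
    then show "Z $$ (j, i) - y j (Suc i) = Z $$ (i, j) - y i (Suc j)"
      using rec[of i j] sym[of "Suc i" j] by (simp add: W_def algebra_simps)
  qed
  moreover have "Y \<in> sym_mats d"
    unfolding Y_def by (rule sym_matsI) (simp add: sym)
  moreover have "shift_sum d X Y = Z"
  proof (rule eq_matI)
    fix i j assume "i < dim_row Z" "j < dim_col Z"
    then have "i < d" "j < d" using Z by auto
    moreover from this have "Suc j mod d < d" by simp
    ultimately show "shift_sum d X Y $$ (i, j) = Z $$ (i, j)"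
      using periodic_mod_eq[of "y i" d "Suc j", OF per]
      by (simp add: shift_sum_index X_def Y_def)
  qed (use Z in \<open>auto simp: shift_sum_def\<close>)
  ultimately show thesis by (rule that)
qed

lemma sym_mats_add:
  "A \<in> sym_mats d \<Longrightarrow> B \<in> sym_mats d \<Longrightarrow> A + B \<in> sym_mats d"
  by (auto simp: sym_mats_def transpose_add)

lemma sym_mats_minus:
  fixes A B :: "'a::group_add mat"
  assumes "A \<in> sym_mats d" "B \<in> sym_mats d"
  shows "A - B \<in> sym_mats d"
  using assms by (auto simp: sym_mats_def transpose_minus)

lemma shift_sum_add:
  fixes X Y X' Y' :: "'a::ab_group_add mat"
  assumes "X \<in> sym_mats d" "Y \<in> sym_mats d" "X' \<in> sym_mats d" "Y' \<in> sym_mats d"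
  shows "shift_sum d (X + X') (Y + Y') = shift_sum d X Y + shift_sum d X' Y'"
  using assms by (intro eq_matI) (auto simp: shift_sum_def sym_matsD algebra_simps)

text \<open>A matrix of fixed dimensions is determined by its entries, so restriction to the index
  rectangle embeds the carrier into a finite function space.\<close>

lemma finite_carrier_mat: "finite (carrier_mat m n :: 'a::finite mat set)"
proof -
  let ?r = "\<lambda>A. restrict (($$) A) ({..<m} \<times> {..<n})"
  have "finite (({..<m} \<times> {..<n}) \<rightarrow>\<^sub>E (UNIV :: 'a set))" by (intro finite_PiE) auto
  moreover have "?r ` carrier_mat m n \<subseteq> ({..<m} \<times> {..<n}) \<rightarrow>\<^sub>E (UNIV :: 'a set)"
    by (auto split: if_splits)
  moreover have "inj_on ?r (carrier_mat m n :: 'a mat set)"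
  proof (rule inj_onI, rule eq_matI)
    fix A B :: "'a mat" and i j
    assume "A \<in> carrier_mat m n" "B \<in> carrier_mat m n" and eq: "?r A = ?r B"
      and "i < dim_row B" "j < dim_col B"
    then have "(i, j) \<in> {..<m} \<times> {..<n}" by auto
    then show "A $$ (i, j) = B $$ (i, j)" using eq by (metis restrict_apply')
  qed auto
  ultimately show ?thesis by (meson finite_imageD finite_subset)
qed

text \<open>Translation by one preimage of \<open>Z\<close> carries the fibre over \<open>Z\<close>
  bijectively onto the kernel.\<close>

lemma card_shift_sum_fibre_eq:
  fixes Z :: "'a::ab_group_add mat"
  assumes Z: "Z \<in> carrier_mat d d"
  shows "card {p \<in> sym_mats d \<times> sym_mats d. shift_sum d (fst p) (snd p) = Z}
       = card {p \<in> sym_mats d \<times> sym_mats d. shift_sum d (fst p) (snd p) = (0\<^sub>m d d :: 'a mat)}"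
proof -
  obtain X Y where XY: "X \<in> sym_mats d" "Y \<in> sym_mats d" "shift_sum d X Y = Z"
    using shift_sum_surj[OF Z] .
  \<comment> \<open>Matrices of varying dimensions do not form a group, so cancellation is
    established for fixed \<open>d\<close>; below, \<open>Z\<close> is likewise cancelled
    entrywise.\<close>
  have cancel: "A - B + B = A" "A + B - B = A"
    if "A \<in> sym_mats d" "B \<in> sym_mats d" for A B :: "'a mat"
    using that by (auto intro!: eq_matI simp: sym_matsD)
  have sub: "shift_sum d (A - X) (B - Y) = 0\<^sub>m d d"
    if "A \<in> sym_mats d" "B \<in> sym_mats d" "shift_sum d A B = Z" for A B
  proof -
    have *: "shift_sum d (A - X) (B - Y) + Z = Z"
      using shift_sum_add[of "A - X" d "B - Y" X Y] that XY
      by (simp add: sym_mats_minus cancel)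
    show ?thesis
    proof (rule eq_matI)
      fix i j assume "i < dim_row (0\<^sub>m d d :: 'a mat)" "j < dim_col (0\<^sub>m d d :: 'a mat)"
      then show "shift_sum d (A - X) (B - Y) $$ (i, j) = 0\<^sub>m d d $$ (i, j)"
        using arg_cong[OF *, of "\<lambda>M. M $$ (i, j)"] Z by auto
    qed (auto simp: shift_sum_def)
  qed
  show ?thesis
    by (rule bij_betw_same_card[where f = "\<lambda>p. (fst p - X, snd p - Y)"],
        rule bij_betw_byWitness[where f' = "\<lambda>p. (fst p + X, snd p + Y)"])
      (use XY Z in \<open>auto simp: cancel sub sym_mats_add sym_mats_minus shift_sum_add\<close>)
qed

text \<open>The fibres partition \<open>A\<close>, so \<open>card A = card B * c\<close> and every
  point of \<open>B\<close> receives mass \<open>c / card A = 1 / card B\<close>.\<close>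

lemma distr_uniform_count_measure_equal_fibres:
  assumes A: "finite A" "A \<noteq> {}" and B: "finite B" and f: "f \<in> A \<rightarrow> B"
    and fibre: "\<And>b. b \<in> B \<Longrightarrow> card {a \<in> A. f a = b} = c"
  shows "distr (uniform_count_measure A) (count_space B) f = uniform_count_measure B"
proof (rule measure_eqI_finite[of _ B])
  fix b assume b: "b \<in> B"
  have "A = (\<Union>b\<in>B. {a \<in> A. f a = b})" using f by auto
  then have "card A = card (\<Union>b\<in>B. {a \<in> A. f a = b})" by simp
  also have "\<dots> = (\<Sum>b\<in>B. card {a \<in> A. f a = b})"
    using A B by (intro card_UN_disjoint) auto
  finally have cA: "card A = card B * c" using fibre by simp
  then have "card B > 0" "c > 0" using A by (metis card_gt_0_iff nat_0_less_mult_iff)+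
  have "f -` {b} \<inter> A = {a \<in> A. f a = b}" by auto
  then have "emeasure (distr (uniform_count_measure A) (count_space B) f) {b}
      = ennreal (real c / real (card A))"
    using b f A fibre[OF b]
    by (simp add: emeasure_distr emeasure_uniform_count_measure measurable_def
        space_uniform_count_measure sets_uniform_count_measure)
  also have "real c / real (card A) = 1 / real (card B)"
    using cA \<open>c > 0\<close> by simp
  finally show "emeasure (distr (uniform_count_measure A) (count_space B) f) {b}
      = emeasure (uniform_count_measure B) {b}"
    using b B by (simp add: emeasure_uniform_count_measure)
qed (use B in \<open>auto simp: sets_uniform_count_measure\<close>)

lemma pair_uniform_count_measure:
  assumes A: "finite A" and B: "finite B"
  shows "uniform_count_measure A \<Otimes>\<^sub>M uniform_count_measure B = uniform_count_measure (A \<times> B)"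
proof (rule measure_eqI_finite[of _ "A \<times> B"])
  have "sets (uniform_count_measure A \<Otimes>\<^sub>M uniform_count_measure B)
      = sets (count_space A \<Otimes>\<^sub>M count_space B)"
    by (intro sets_pair_measure_cong) (simp_all add: sets_uniform_count_measure)
  then show "sets (uniform_count_measure A \<Otimes>\<^sub>M uniform_count_measure B) = Pow (A \<times> B)"
    by (simp only: pair_measure_count_space[OF A B] sets_count_space)
  fix p assume "p \<in> A \<times> B"
  then obtain a b where p: "p = (a, b)" "a \<in> A" "b \<in> B" by auto
  \<comment> \<open>Finiteness supplies the sigma-finiteness behind the product formula for
    rectangles.\<close>
  interpret B: finite_measure "uniform_count_measure B"
    by (rule finite_measureI) (simp add: space_uniform_count_measure emeasure_uniform_count_measure B)
  have "emeasure (uniform_count_measure A \<Otimes>\<^sub>M uniform_count_measure B) ({a} \<times> {b})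
      = emeasure (uniform_count_measure A) {a} * emeasure (uniform_count_measure B) {b}"
    using p by (intro B.emeasure_pair_measure_Times) (auto simp: sets_uniform_count_measure)
  then show "emeasure (uniform_count_measure A \<Otimes>\<^sub>M uniform_count_measure B) {p}
      = emeasure (uniform_count_measure (A \<times> B)) {p}"
    using p A B
    by (simp add: emeasure_uniform_count_measure ennreal_mult[symmetric] card_cartesian_product)
qed (use A B in \<open>auto simp: sets_uniform_count_measure\<close>)

theorem claim3p6:
  fixes d :: nat
    and M :: "'w measure"
    and X Y :: "'w \<Rightarrow> 'a::{finite,field} mat"
  assumes "0 < d"
    and "prob_space M"
    and "prob_space.indep_var M (count_space (sym_mats d)) X (count_space (sym_mats d)) Y"
    and "distr M (count_space (sym_mats d)) X = uniform_count_measure (sym_mats d)"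
    and "distr M (count_space (sym_mats d)) Y = uniform_count_measure (sym_mats d)"
  shows "(\<lambda>\<omega>. shift_sum d (X \<omega>) (Y \<omega>)) \<in> measurable M (count_space (carrier_mat d d)) \<and>
    distr M (count_space (carrier_mat d d)) (\<lambda>\<omega>. shift_sum d (X \<omega>) (Y \<omega>))
      = uniform_count_measure (carrier_mat d d)"
proof -
  interpret prob_space M by fact
  let ?S = "sym_mats d :: 'a mat set"
  let ?C = "count_space (carrier_mat d d :: 'a mat set)"
  let ?f = "\<lambda>p :: 'a mat \<times> 'a mat. shift_sum d (fst p) (snd p)"
  have fin: "finite ?S"
    by (rule finite_subset[OF _ finite_carrier_mat[of d d]]) (auto simp: sym_mats_def)
  have indep: "random_variable (count_space ?S) X" "random_variable (count_space ?S) Y"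
    "distr M (count_space ?S) X \<Otimes>\<^sub>M distr M (count_space ?S) Y
      = distr M (count_space ?S \<Otimes>\<^sub>M count_space ?S) (\<lambda>\<omega>. (X \<omega>, Y \<omega>))"
    using assms(3) indep_var_distribution_eq by blast+
  have pair: "count_space ?S \<Otimes>\<^sub>M count_space ?S = count_space (?S \<times> ?S)"
    using fin by (simp add: pair_measure_count_space)
  have XY: "(\<lambda>\<omega>. (X \<omega>, Y \<omega>)) \<in> measurable M (count_space (?S \<times> ?S))"
    using measurable_Pair[OF indep(1,2)] by (simp add: pair)
  have f: "?f \<in> measurable (count_space (?S \<times> ?S)) ?C"
    by (auto simp: shift_sum_def)
  have "(\<lambda>\<omega>. shift_sum d (X \<omega>) (Y \<omega>)) \<in> measurable M ?C"
    using measurable_compose[OF XY f] by simp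
  moreover have "distr M ?C (\<lambda>\<omega>. shift_sum d (X \<omega>) (Y \<omega>))
      = uniform_count_measure (carrier_mat d d)"
  proof -
    have "distr M ?C (\<lambda>\<omega>. shift_sum d (X \<omega>) (Y \<omega>))
        = distr (distr M (count_space (?S \<times> ?S)) (\<lambda>\<omega>. (X \<omega>, Y \<omega>))) ?C ?f"
      by (simp add: distr_distr[OF f XY] comp_def)
    \<comment> \<open>Independence makes the joint law the product of the two uniform marginals,
      which is uniform on pairs.\<close>
    also have "distr M (count_space (?S \<times> ?S)) (\<lambda>\<omega>. (X \<omega>, Y \<omega>))
        = uniform_count_measure (?S \<times> ?S)"
      using indep(3) fin by (simp add: assms(4,5) pair pair_uniform_count_measure)
    also have "distr \<dots> ?C ?f = uniform_count_measure (carrier_mat d d)"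
    proof (rule distr_uniform_count_measure_equal_fibres)
      have "(0\<^sub>m d d :: 'a mat) \<in> ?S" by (auto simp: sym_mats_def)
      then show "?S \<times> ?S \<noteq> {}" by auto
      show "?f \<in> ?S \<times> ?S \<rightarrow> carrier_mat d d" by (auto simp: shift_sum_def)
    \<comment> \<open>The common fibre size is the number of symmetric pairs that \<open>?f\<close>
      sends to zero.\<close>
    qed (use fin finite_carrier_mat card_shift_sum_fibre_eq in auto)
    finally show ?thesis .
  qed
  ultimately show ?thesis ..
qed

end
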